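(* Let $G$ be a bipartite graph with $\alpha(G)=\alpha\geq 1$. Then $$s_{\lceil(2\alpha-1)/3\rceil}\geq\cdots\geq s_{\alpha-1}\geq s_{\alpha},$$ i.e. $s_k\geq s_{k+1}$ for every integer $k$ with $\lceil(2\alpha-1)/3\rceil\leq k<\alpha$.
   Context: All graphs are finite, undirected, without loops or multiple edges. A stable set is a set of pairwise non-adjacent vertices (the empty set is stable). The stability number $\alpha(G)$ is the maximum cardinality of a stable set in $G$, and $s_k$ denotes the number of stable sets of cardinality $k$ in $G$, for $0\leq k\leq\alpha(G)$. *)

theory Defs
  imports Complex_Main "Graph_Theory.Digraph"
begin

text \<open>
  Finite simple undirected graphs are the locale \<^locale>\<open>graph\<close>: an undirected edge is represented
  by two opposite arcs, and \<open>u \<rightarrow>\<^bsub>G\<^esub> v\<close> is the (symmetric, irreflexive) adjacency relation.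
\<close>

definition bipartite :: "('a, 'b) pre_digraph \<Rightarrow> bool" where
  "bipartite G \<longleftrightarrow> (\<exists>A B. A \<union> B = verts G \<and> A \<inter> B = {} \<and>
     (\<forall>u v. u \<rightarrow>\<^bsub>G\<^esub> v \<longrightarrow> (u \<in> A \<and> v \<in> B) \<or> (u \<in> B \<and> v \<in> A)))"

definition stable_set :: "('a, 'b) pre_digraph \<Rightarrow> 'a set \<Rightarrow> bool" where
  "stable_set G S \<longleftrightarrow> S \<subseteq> verts G \<and> pairwise (\<lambda>u v. \<not> u \<rightarrow>\<^bsub>G\<^esub> v) S"

definition stability_number :: "('a, 'b) pre_digraph \<Rightarrow> nat" where
  "stability_number G = Max {card S | S. stable_set G S}"

definition num_stable_sets :: "('a, 'b) pre_digraph \<Rightarrow> nat \<Rightarrow> nat" where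
  "num_stable_sets G k = card {S. stable_set G S \<and> card S = k}"

end

theory Submission
  imports Defs
begin

text \<open>
  Count pairs of a stable set \<open>S\<close> of size \<open>k\<close> and a vertex \<open>v \<notin> S\<close> extending it to a stable set.
  Each stable set of size \<open>k + 1\<close> arises from \<open>k + 1\<close> such pairs. The extending vertices of \<open>S\<close>
  in one colour class are pairwise non-adjacent, so together with \<open>S\<close> they form a stable set; hence
  each class contains at most \<open>\<alpha> - k\<close> of them. Thus
  \<open>(k + 1) s\<^bsub>k+1\<^esub> \<le> 2 (\<alpha> - k) s\<^bsub>k\<^esub>\<close>, and \<open>2 (\<alpha> - k) \<le> k + 1\<close> as soon as \<open>k \<ge> (2\<alpha> - 1) / 3\<close>.
\<close>

text \<open>Excluding the vertices of \<open>S\<close> makes every extension strictly larger. That a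
  member lies in \<open>verts G\<close> is already part of \<open>stable_set\<close>.\<close>

definition stable_extensions :: "('a, 'b) pre_digraph \<Rightarrow> 'a set \<Rightarrow> 'a set" where
  "stable_extensions G S = {v. v \<notin> S \<and> stable_set G (insert v S)}"

lemma stable_set_subset:
  assumes "stable_set G T" "S \<subseteq> T"
  shows "stable_set G S"
  using assms pairwise_subset unfolding stable_set_def by blast

lemma stable_set_finite:
  assumes "finite (verts G)" "stable_set G S"
  shows "finite S"
  using assms finite_subset unfolding stable_set_def by blast

lemma finite_stable_sets:
  assumes "finite (verts G)"
  shows "finite {S. stable_set G S \<and> P S}"
  by (rule finite_subset[of _ "Pow (verts G)"]) (use assms in \<open>auto simp: stable_set_def\<close>)

lemma stable_extensions_subset: "stable_extensions G S \<subseteq> verts G"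
  unfolding stable_extensions_def stable_set_def by auto

lemma card_le_stability_number:
  assumes "finite (verts G)" "stable_set G S"
  shows "card S \<le> stability_number G"
proof -
  have "finite {card S | S. stable_set G S}"
    using finite_stable_sets[OF assms(1), of "\<lambda>_. True"] by simp
  then show ?thesis
    unfolding stability_number_def using assms(2) by (intro Max_ge) auto
qed

text \<open>\<open>X \<union> S\<close> is itself stable: pairs inside \<open>X\<close> are covered
  by \<open>indep\<close>, pairs inside \<open>S\<close> by stability of \<open>S\<close>, and a
  mixed pair with \<open>v \<in> X\<close> lies in the stable set \<open>insert v S\<close>. As
  \<open>X\<close> and \<open>S\<close> are disjoint, their cardinalities add up.\<close>

lemma card_independent_extensions_le:
  assumes "finite (verts G)" "stable_set G S"
    and X: "X \<subseteq> stable_extensions G S"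
    and indep: "\<And>u v. u \<in> X \<Longrightarrow> v \<in> X \<Longrightarrow> \<not> u \<rightarrow>\<^bsub>G\<^esub> v"
  shows "card X + card S \<le> stability_number G"
proof -
  have ext: "v \<in> verts G" "v \<notin> S" "pairwise (\<lambda>u v. \<not> u \<rightarrow>\<^bsub>G\<^esub> v) (insert v S)" if "v \<in> X" for v
    using that X by (auto simp: stable_extensions_def stable_set_def)
  have "stable_set G (X \<union> S)"
    unfolding stable_set_def
  proof (intro conjI pairwiseI)
    show "X \<union> S \<subseteq> verts G"
      using ext(1) assms(2) by (auto simp: stable_set_def)
  next
    fix u v
    assume uv: "u \<in> X \<union> S" "v \<in> X \<union> S" "u \<noteq> v"
    then consider "u \<in> X" "v \<in> X" | "u \<in> X" "v \<in> S" | "u \<in> S" "v \<in> X" | "u \<in> S" "v \<in> S"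
      by blast
    then show "\<not> u \<rightarrow>\<^bsub>G\<^esub> v"
    proof cases
      case 1
      then show ?thesis by (rule indep)
    next
      case 2
      then show ?thesis using pairwiseD[OF ext(3)] uv(3) by simp
    next
      case 3
      then show ?thesis using pairwiseD[OF ext(3)] uv(3) by simp
    next
      case 4
      then show ?thesis using assms(2) uv(3) by (auto simp: stable_set_def dest: pairwiseD)
    qed
  qed
  then have "card (X \<union> S) \<le> stability_number G"
    by (rule card_le_stability_number[OF assms(1)])
  moreover have "finite X"
    using X stable_extensions_subset assms(1) by (meson finite_subset)
  moreover have "X \<inter> S = {}"
    using X by (auto simp: stable_extensions_def)
  ultimately show ?thesis
    using stable_set_finite[OF assms(1,2)] by (simp add: card_Un_disjoint)
qed

lemma card_stable_extensions_le:
  assumes "finite (verts G)" "bipartite G" "stable_set G S"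
  shows "card (stable_extensions G S) \<le> 2 * (stability_number G - card S)"
proof -
  obtain A B where AB: "A \<union> B = verts G" "A \<inter> B = {}"
    "\<And>u v. u \<rightarrow>\<^bsub>G\<^esub> v \<Longrightarrow> (u \<in> A \<and> v \<in> B) \<or> (u \<in> B \<and> v \<in> A)"
    using assms(2) unfolding bipartite_def by blast
  let ?E = "stable_extensions G S"
  \<comment> \<open>An arc inside \<open>A\<close> would force one of its ends into \<open>B\<close>
    as well, against disjointness; this also excludes loops, so \<open>indep\<close> holds even for
    \<open>u = v\<close>.\<close>
  have "card (?E \<inter> A) + card S \<le> stability_number G"
    by (rule card_independent_extensions_le[OF assms(1,3)]) (use AB(2) in \<open>auto dest: AB(3)\<close>)
  moreover have "card (?E \<inter> B) + card S \<le> stability_number G"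
    by (rule card_independent_extensions_le[OF assms(1,3)]) (use AB(2) in \<open>auto dest: AB(3)\<close>)
  moreover have "?E = (?E \<inter> A) \<union> (?E \<inter> B)"
    using AB(1) stable_extensions_subset[of G S] by auto
  then have "card ?E \<le> card (?E \<inter> A) + card (?E \<inter> B)"
    using card_Un_le[of "?E \<inter> A" "?E \<inter> B"] by simp
  \<comment> \<open>Either bound implies \<open>card S \<le> stability_number G\<close>, so the
    truncated subtraction is exact here.\<close>
  ultimately show ?thesis by linarith
qed

lemma Suc_mult_num_stable_sets:
  assumes "finite (verts G)"
  shows "Suc k * num_stable_sets G (Suc k) =
    (\<Sum>S | stable_set G S \<and> card S = k. card (stable_extensions G S))"
proof -
  let ?F = "\<lambda>k. {S. stable_set G S \<and> card S = k}"
  let ?P = "SIGMA S:?F k. stable_extensions G S"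
  let ?Q = "SIGMA T:?F (Suc k). T"
  have fin: "finite S" if "stable_set G S" for S
    using that stable_set_finite[OF assms] by blast
  \<comment> \<open>Keeping \<open>v\<close> as second component makes the map invertible:
    \<open>insert v S\<close> alone does not reveal which vertex was added, but with
    \<open>v\<close> recorded, deleting it recovers \<open>S\<close>.\<close>
  have "bij_betw (\<lambda>(S, v). (insert v S, v)) ?P ?Q"
  proof (rule bij_betw_byWitness[where f' = "\<lambda>(T, v). (T - {v}, v)"])
    show "(\<lambda>(S, v). (insert v S, v)) ` ?P \<subseteq> ?Q"
      by (auto simp: stable_extensions_def fin)
    show "(\<lambda>(T, v). (T - {v}, v)) ` ?Q \<subseteq> ?P"
    proof
      fix p
      assume "p \<in> (\<lambda>(T, v). (T - {v}, v)) ` ?Q"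
      then obtain T v where "p = (T - {v}, v)" "stable_set G T" "v \<in> T" "card T = Suc k"
        by auto
      then show "p \<in> ?P"
        using stable_set_subset[of G T "T - {v}"]
        by (simp add: stable_extensions_def insert_absorb)
    qed
  qed (auto simp: stable_extensions_def)
  then have "card ?P = card ?Q" by (rule bij_betw_same_card)
  moreover have "card ?P = (\<Sum>S\<in>?F k. card (stable_extensions G S))"
    using finite_stable_sets[OF assms] finite_subset[OF stable_extensions_subset assms]
    by (intro card_SigmaI) auto
  moreover have "card ?Q = (\<Sum>T\<in>?F (Suc k). card T)"
    using finite_stable_sets[OF assms] fin by (intro card_SigmaI) auto
  moreover have "\<dots> = Suc k * num_stable_sets G (Suc k)"
    by (simp add: num_stable_sets_def)
  ultimately show ?thesis by simp
qed

text \<open>The bound on extensions is applied to each summand of the double count. For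
  \<open>k\<close> above the stability number both sides vanish, in agreement with truncated
  subtraction.\<close>

lemma bipartite_num_stable_sets_Suc_le:
  assumes "finite (verts G)" "bipartite G"
  shows "Suc k * num_stable_sets G (Suc k) \<le> 2 * (stability_number G - k) * num_stable_sets G k"
proof -
  have "(\<Sum>S | stable_set G S \<and> card S = k. card (stable_extensions G S))
      \<le> (\<Sum>S | stable_set G S \<and> card S = k. 2 * (stability_number G - k))"
    using card_stable_extensions_le[OF assms] by (intro sum_mono) auto
  then show ?thesis
    unfolding Suc_mult_num_stable_sets[OF assms(1)]
    by (simp add: num_stable_sets_def mult.commute)
qed

theorem corollary2p7:
  fixes G :: "('a, 'b) pre_digraph" and \<alpha> :: nat
  assumes "graph G"
    and "bipartite G"
    and "stability_number G = \<alpha>"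
    and "\<alpha> \<ge> 1"
  shows "\<forall>k::nat. \<lceil>(2 * real \<alpha> - 1) / 3\<rceil> \<le> int k \<and> k < \<alpha> \<longrightarrow>
           num_stable_sets G k \<ge> num_stable_sets G (k + 1)"
proof (intro allI impI)
  fix k :: nat
  assume k: "\<lceil>(2 * real \<alpha> - 1) / 3\<rceil> \<le> int k \<and> k < \<alpha>"
  interpret graph G by fact
  have "(2 * real \<alpha> - 1) / 3 \<le> real k"
    using k by (simp add: ceiling_le_iff)
  \<comment> \<open>Moving the 1 across leaves only sums and products of naturals, so the bound
    transfers from reals to \<open>nat\<close> without truncation.\<close>
  then have "2 * real \<alpha> \<le> real (3 * k + 1)"
    by simp
  then have "2 * (\<alpha> - k) \<le> Suc k"
    by linarith
  \<comment> \<open>The factor \<open>2 * (\<alpha> - k)\<close> is replaced by the larger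
    \<open>Suc k\<close>, which is positive and can then be cancelled.\<close>
  then have "Suc k * num_stable_sets G (Suc k) \<le> Suc k * num_stable_sets G k"
    using bipartite_num_stable_sets_Suc_le[OF finite_verts assms(2), of k] assms(3)
    by (meson le_trans mult_le_mono1)
  then show "num_stable_sets G k \<ge> num_stable_sets G (k + 1)"
    unfolding Suc_eq_plus1[symmetric] by (simp only: Suc_mult_le_cancel1)
qed

end
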